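(* Let $p>1$, $q\ge p$. Assume that an $s$-stage DIRK scheme is at least first order accurate, that it is discretely Bochner stable with these exponents $p,q$ and with constants $C_A,C_f,\{\omega_i\}_{i=1}^s,\{\gamma_i\}_{i=1}^s>0$, i.e. for all $\mathfrak N\in\mathbb N$, any partition $\mathcal P_{\mathfrak N}$ and all $n\in\{0,\dots,\mathfrak N-1\}$, $$\tfrac12|u_{n+1}|^2+C_A\tau_n\sum_{i=1}^s\omega_i\|v_{n,i}\|^p\le\tfrac12|u_n|^2+C_f\tau_n\sum_{i=1}^s\gamma_i\|f_{n,i}\|_*^{q'},$$ and that $$\mathfrak C_3=\sup_{\mathfrak N\in\mathbb N}\ \sup_{\mathcal P_{\mathfrak N}}\ \sup_{n\in\{0,\dots,\mathfrak N-1\}}\ \max_{1\le i\le s}C_3(|v_{n,i}|)<\infty.$$ Then, for any $\mathfrak N\in\mathbb N$ and any partition $\mathcal P_{\mathfrak N}$ of $[0,t_f]$, the solution of the scheme satisfies $$\left[\mu\sum_{n=0}^{\mathfrak N-1}\tau_n\left\|\frac{u_{n+1}-u_n}{\tau_n}\right\|_*^{q'}\right]^{1/q'}\le(\mu t_f)^{\frac{p'-q'}{p'q'}}\left(\sum_{n=0}^{\mathfrak N-1}\tau_n\sum_{i=1}^s\gamma_i\|f(t_n+c_i\tau_n)\|_*^{p'}\right)^{1/p'}+\mathfrak C_3\left[\sum_{n=0}^{\mathfrak N-1}\tau_n\sum_{i=1}^s\omega_i\|v_{n,i}\|^p\right]^{1/q'},$$ where $\mu=\min\{\min_{1\le i\le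 s}\gamma_i,\ \min_{1\le i\le s}\omega_i\}$ and $\mathfrak C_3>0$.
   Context: $\mathbb V\subset\mathbb H\subset\mathbb V^*$ is a Gelfand triple: $\mathbb H$ is a separable (real) Hilbert space with inner product $(\cdot,\cdot)$ and norm $|\cdot|$; $\mathbb V$ is a Banach space with norm $\|\cdot\|$, dual $\mathbb V^*$ with norm $\|\cdot\|_*$, and duality pairing $\langle\cdot,\cdot\rangle$; every $v\in\mathbb H$ is identified with the element of $\mathbb V^*$ given by $\langle v,w\rangle=(v,w)$ for all $w\in\mathbb V$. For $r\in(1,\infty)$, $r'=r/(r-1)$. Let $t_f>0$, $u_0\in\mathbb H$, $f:[0,t_f]\to\mathbb V^*$ (with meaningful point values) and $\mathcal A:\mathbb V\to\mathbb V^*$; the problem approximated is $\frac{du}{dt}=f(t)-\mathcal A(u)$, $u(0)=u_0$. Standing assumptions on $\mathcal A$: local solvability (for every $F\in\mathbb V^*$ there is $\beta>0$ such that for all $\gamma\in(0,\beta]$ the problem $v+\gamma\mathcal A(v)=F$ has a unique solution $v\in\mathbb V$); $p$-coercivity: there is $C_1>0$ with $\langle\mathcal A(w),w\rangle\ge C_1\|w\|^p$ for all $w\in\mathbb V$; $q$-growth: there is an increasing function $C_3:\mathbb R\to\mathbb R$ with $\|\mathcal A(w)\|_*\le C_3(|w|)\|w\|^{p/q'}$ for all $w\in\mathbb V$. An $s$-stage DIRK scheme has a tableau with lower triangular matrix $\mathbf A=[a_{ij}]\in\mathbb R^{s\times s}$ with positive diagonal entries, weights $b_i\in[0,1]$ and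 nodes $c_i\in[0,1]$. For a partition $\mathcal P_{\mathfrak N}$: $0=t_0<\dots<t_{\mathfrak N}=t_f$, $\tau_n=t_{n+1}-t_n$, it produces (equations in $\mathbb V^*$) $v_{n,i}=u_n+\tau_n\sum_{j=1}^i a_{ij}\mathscr F_{n,j}$ for $i=1,\dots,s$, $u_{n+1}=u_n+\tau_n\sum_{j=1}^s b_j\mathscr F_{n,j}$, where $f_{n,j}=f(t_n+c_j\tau_n)$, $\mathscr F_{n,j}=f_{n,j}-\mathcal A(v_{n,j})$, $v_{n,i}\in\mathbb V$, $u_n\in\mathbb H$. At least first order accurate means $\sum_{i=1}^s b_i=1$ and $\sum_{j=1}^s a_{ij}=c_i$ for all $i$.
   Formalization: The closing claim that the supremum of C_3(|v_{n,i}|) is positive is proved only when some stage v_{n,i} of some solution is nonzero; if all stages vanish (e.g. f=0, u_0=0) and C_3(0)=0, it fails. The inequality itself is proved without this condition. *)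

theory Defs
  imports "HOL-Analysis.Analysis"
begin

definition conj_exp :: "real \<Rightarrow> real" where
  "conj_exp r = r / (r - 1)"

text \<open>The inclusion of V in H is given by a continuous linear injection \<open>\<iota>\<close> with dense range.
  The dual of V is the type \<open>'v \<Rightarrow>\<^sub>L real\<close>, whose norm is the operator norm.\<close>

definition gelfand_triple ::
  "('v::banach \<Rightarrow>\<^sub>L 'h::{real_inner, complete_space}) \<Rightarrow> bool" where
  "gelfand_triple \<iota> \<longleftrightarrow>
     (\<exists>D :: 'h set. countable D \<and> closure D = UNIV) \<and>
     inj (blinfun_apply \<iota>) \<and>
     closure (range (blinfun_apply \<iota>)) = UNIV"

text \<open>The identification of \<open>h\<close> in H with the functional \<open>w \<mapsto> (h, \<iota> w)\<close> on V.\<close>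

definition to_dual ::
  "('v::banach \<Rightarrow>\<^sub>L 'h::{real_inner, complete_space}) \<Rightarrow> 'h \<Rightarrow> ('v \<Rightarrow>\<^sub>L real)" where
  "to_dual \<iota> h = blinfun_inner_right h o\<^sub>L \<iota>"

definition locally_solvable ::
  "('v::banach \<Rightarrow>\<^sub>L 'h::{real_inner, complete_space}) \<Rightarrow> ('v \<Rightarrow> ('v \<Rightarrow>\<^sub>L real)) \<Rightarrow> bool" where
  "locally_solvable \<iota> \<A> \<longleftrightarrow>
     (\<forall>F. \<exists>\<beta>>0. \<forall>\<gamma>. 0 < \<gamma> \<and> \<gamma> \<le> \<beta> \<longrightarrow> (\<exists>!v. to_dual \<iota> (\<iota> v) + \<gamma> *\<^sub>R \<A> v = F))"

definition coercive :: "real \<Rightarrow> ('v::banach \<Rightarrow> ('v \<Rightarrow>\<^sub>L real)) \<Rightarrow> bool" where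
  "coercive p \<A> \<longleftrightarrow> (\<exists>C1>0. \<forall>w. blinfun_apply (\<A> w) w \<ge> C1 * norm w powr p)"

definition growth ::
  "('v::banach \<Rightarrow>\<^sub>L 'h::{real_inner, complete_space}) \<Rightarrow> real \<Rightarrow> real \<Rightarrow> (real \<Rightarrow> real)
     \<Rightarrow> ('v \<Rightarrow> ('v \<Rightarrow>\<^sub>L real)) \<Rightarrow> bool" where
  "growth \<iota> p q C3 \<A> \<longleftrightarrow>
     mono C3 \<and> (\<forall>w. norm (\<A> w) \<le> C3 (norm (\<iota> w)) * norm w powr (p / conj_exp q))"

text \<open>Stages are indexed by \<open>1, \<dots>, s\<close>; values of \<open>a\<close>, \<open>b\<close>, \<open>c\<close> at other indices play no role.\<close>

definition dirk_tableau ::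
  "nat \<Rightarrow> (nat \<Rightarrow> nat \<Rightarrow> real) \<Rightarrow> (nat \<Rightarrow> real) \<Rightarrow> (nat \<Rightarrow> real) \<Rightarrow> bool" where
  "dirk_tableau s a b c \<longleftrightarrow>
     s \<ge> 1 \<and>
     (\<forall>i\<in>{1..s}. \<forall>j\<in>{1..s}. i < j \<longrightarrow> a i j = 0) \<and>
     (\<forall>i\<in>{1..s}. a i i > 0) \<and>
     (\<forall>i\<in>{1..s}. b i \<in> {0..1} \<and> c i \<in> {0..1})"

definition first_order ::
  "nat \<Rightarrow> (nat \<Rightarrow> nat \<Rightarrow> real) \<Rightarrow> (nat \<Rightarrow> real) \<Rightarrow> (nat \<Rightarrow> real) \<Rightarrow> bool" where
  "first_order s a b c \<longleftrightarrow>
     (\<Sum>i=1..s. b i) = 1 \<and> (\<forall>i\<in>{1..s}. (\<Sum>j=1..s. a i j) = c i)"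

definition time_partition :: "real \<Rightarrow> nat \<Rightarrow> (nat \<Rightarrow> real) \<Rightarrow> bool" where
  "time_partition tf N t \<longleftrightarrow> t 0 = 0 \<and> t N = tf \<and> (\<forall>n<N. t n < t (Suc n))"

definition step :: "(nat \<Rightarrow> real) \<Rightarrow> nat \<Rightarrow> real" where
  "step t n = t (Suc n) - t n"

definition stage_rhs :: "(real \<Rightarrow> 'd) \<Rightarrow> (nat \<Rightarrow> real) \<Rightarrow> (nat \<Rightarrow> real) \<Rightarrow> nat \<Rightarrow> nat \<Rightarrow> 'd" where
  "stage_rhs f c t n i = f (t n + c i * step t n)"

definition stage_slope ::
  "(real \<Rightarrow> ('v::banach \<Rightarrow>\<^sub>L real)) \<Rightarrow> ('v \<Rightarrow> ('v \<Rightarrow>\<^sub>L real)) \<Rightarrow> (nat \<Rightarrow> real) \<Rightarrow> (nat \<Rightarrow> real)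
     \<Rightarrow> (nat \<Rightarrow> nat \<Rightarrow> 'v) \<Rightarrow> nat \<Rightarrow> nat \<Rightarrow> ('v \<Rightarrow>\<^sub>L real)" where
  "stage_slope f \<A> c t v n j = stage_rhs f c t n j - \<A> (v n j)"

text \<open>Both families of equations hold in the dual of V. A solution is a pair \<open>(u, v)\<close>; neither
  existence nor uniqueness is part of the notion, since local solvability gives them only for
  sufficiently small step sizes.\<close>

definition dirk_solution ::
  "('v::banach \<Rightarrow>\<^sub>L 'h::{real_inner, complete_space}) \<Rightarrow> (real \<Rightarrow> ('v \<Rightarrow>\<^sub>L real))
     \<Rightarrow> ('v \<Rightarrow> ('v \<Rightarrow>\<^sub>L real)) \<Rightarrow> 'h
     \<Rightarrow> nat \<Rightarrow> (nat \<Rightarrow> nat \<Rightarrow> real) \<Rightarrow> (nat \<Rightarrow> real) \<Rightarrow> (nat \<Rightarrow> real)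
     \<Rightarrow> nat \<Rightarrow> (nat \<Rightarrow> real) \<Rightarrow> (nat \<Rightarrow> 'h) \<Rightarrow> (nat \<Rightarrow> nat \<Rightarrow> 'v) \<Rightarrow> bool" where
  "dirk_solution \<iota> f \<A> u0 s a b c N t u v \<longleftrightarrow>
     u 0 = u0 \<and>
     (\<forall>n<N.
        (\<forall>i\<in>{1..s}. to_dual \<iota> (\<iota> (v n i)) =
           to_dual \<iota> (u n) + step t n *\<^sub>R (\<Sum>j=1..i. a i j *\<^sub>R stage_slope f \<A> c t v n j)) \<and>
        to_dual \<iota> (u (Suc n)) =
           to_dual \<iota> (u n) + step t n *\<^sub>R (\<Sum>j=1..s. b j *\<^sub>R stage_slope f \<A> c t v n j))"

definition discretely_Bochner_stable ::
  "('v::banach \<Rightarrow>\<^sub>L 'h::{real_inner, complete_space}) \<Rightarrow> (real \<Rightarrow> ('v \<Rightarrow>\<^sub>L real))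
     \<Rightarrow> ('v \<Rightarrow> ('v \<Rightarrow>\<^sub>L real)) \<Rightarrow> 'h \<Rightarrow> real
     \<Rightarrow> nat \<Rightarrow> (nat \<Rightarrow> nat \<Rightarrow> real) \<Rightarrow> (nat \<Rightarrow> real) \<Rightarrow> (nat \<Rightarrow> real)
     \<Rightarrow> real \<Rightarrow> real \<Rightarrow> real \<Rightarrow> real \<Rightarrow> (nat \<Rightarrow> real) \<Rightarrow> (nat \<Rightarrow> real) \<Rightarrow> bool" where
  "discretely_Bochner_stable \<iota> f \<A> u0 tf s a b c p q CA Cf \<omega> \<gamma> \<longleftrightarrow>
     CA > 0 \<and> Cf > 0 \<and> (\<forall>i\<in>{1..s}. \<omega> i > 0 \<and> \<gamma> i > 0) \<and>
     (\<forall>N t u v. time_partition tf N t \<and> dirk_solution \<iota> f \<A> u0 s a b c N t u v \<longrightarrow>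
        (\<forall>n<N.
           1/2 * (norm (u (Suc n)))\<^sup>2
             + CA * step t n * (\<Sum>i=1..s. \<omega> i * norm (v n i) powr p)
           \<le> 1/2 * (norm (u n))\<^sup>2
             + Cf * step t n * (\<Sum>i=1..s. \<gamma> i * norm (stage_rhs f c t n i) powr conj_exp q)))"

text \<open>The supremum of these values is the constant bounding \<open>C3\<close> along all stages.\<close>

definition stage_growth_values ::
  "('v::banach \<Rightarrow>\<^sub>L 'h::{real_inner, complete_space}) \<Rightarrow> (real \<Rightarrow> ('v \<Rightarrow>\<^sub>L real))
     \<Rightarrow> ('v \<Rightarrow> ('v \<Rightarrow>\<^sub>L real)) \<Rightarrow> 'h \<Rightarrow> real
     \<Rightarrow> nat \<Rightarrow> (nat \<Rightarrow> nat \<Rightarrow> real) \<Rightarrow> (nat \<Rightarrow> real) \<Rightarrow> (nat \<Rightarrow> real)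
     \<Rightarrow> (real \<Rightarrow> real) \<Rightarrow> real set" where
  "stage_growth_values \<iota> f \<A> u0 tf s a b c C3 =
     {Max ((\<lambda>i. C3 (norm (\<iota> (v n i)))) ` {1..s}) | N t u v n.
        time_partition tf N t \<and> dirk_solution \<iota> f \<A> u0 s a b c N t u v \<and> n < N}"

end

theory Submission
  imports Defs
begin

text \<open>The difference quotient is the \<open>b\<close>-average of the slopes, so Jensen's inequality bounds its
  \<open>q'\<close>-th power by a weighted sum over all pairs (step, stage) with weights \<open>\<mu> \<tau>\<^sub>n b\<^sub>j\<close> of total
  mass \<open>\<mu> t\<^sub>f\<close>. Minkowski's inequality for these weights separates the data from the operator.
  The data term is raised from \<open>q'\<close> to \<open>p'\<close> by the power mean inequality, the operator term is
  controlled by \<open>q\<close>-growth, and \<open>b\<^sub>j \<le> 1\<close> together with the choice of \<open>\<mu>\<close> turns the weights into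
  \<open>\<gamma>\<^sub>j\<close> and \<open>\<omega>\<^sub>j\<close>.\<close>

section \<open>Convexity of powers: Jensen, power means and Minkowski for finite weighted
  sums\<close>

text \<open>For positive arguments this is \<open>powr_convex\<close>. The endpoint 0 matters
  because norms may vanish; there the inequality reduces to \<theta>^r \<le> \<theta> for 0 <
  \<theta> < 1 and r \<ge> 1, which is \<open>scale\<close>.\<close>

lemma convex_on_powr_nonneg:
  fixes r :: real
  assumes "r \<ge> 1"
  shows "convex_on {0..} (\<lambda>x. x powr r)"
proof (rule convex_onI)
  fix t x y :: real
  assume t: "0 < t" "t < 1" and xy: "x \<in> {0..}" "y \<in> {0..}"
  have scale: "\<theta> powr r * z powr r \<le> \<theta> * z powr r" if "0 < \<theta>" "\<theta> < 1" for \<theta> z :: real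
    using powr_mono'[of 1 r \<theta>] that assms by (intro mult_right_mono) auto
  have pos: "((1 - t) *\<^sub>R x + t *\<^sub>R y) powr r \<le> (1 - t) * x powr r + t * y powr r"
    if "x > 0" "y > 0"
    using convex_onD[OF powr_convex[OF assms], of t x y] that t by auto
  consider "x = 0" | "y = 0" | "x > 0" "y > 0"
    using xy by force
  then show "((1 - t) *\<^sub>R x + t *\<^sub>R y) powr r \<le> (1 - t) * x powr r + t * y powr r"
  proof cases
    case 1
    then show ?thesis using scale[of t y] t assms by (simp add: powr_mult)
  next
    case 2
    then show ?thesis using scale[of "1 - t" x] t assms by (simp add: powr_mult)
  next
    case 3
    then show ?thesis by (rule pos)
  qed
qed simp

lemma powr_weighted_sum_le:
  fixes w x :: "'i \<Rightarrow> real"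
  assumes "finite I" "r \<ge> 1" "sum w I = 1"
    and "\<And>i. i \<in> I \<Longrightarrow> w i \<ge> 0" "\<And>i. i \<in> I \<Longrightarrow> x i \<ge> 0"
  shows "(\<Sum>i\<in>I. w i * x i) powr r \<le> (\<Sum>i\<in>I. w i * x i powr r)"
proof -
  have "I \<noteq> {}" using assms(3) by auto
  then show ?thesis
    using convex_on_sum[OF assms(1) _ convex_on_powr_nonneg[OF assms(2)], of w x] assms
    by simp
qed

text \<open>Jensen with exponent \<open>k / r\<close>, applied to the values
  \<open>x i powr r\<close> under the normalised weights \<open>w i / M\<close>; the
  \<open>k\<close>-th root then leaves a power of the total mass \<open>M\<close>.\<close>

lemma weighted_power_mean_le:
  fixes w x :: "'i \<Rightarrow> real"
  assumes "finite I" "0 < r" "r \<le> k" "sum w I > 0"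
    and w: "\<And>i. i \<in> I \<Longrightarrow> w i \<ge> 0"
  shows "(\<Sum>i\<in>I. w i * x i powr r) powr (1 / r)
    \<le> sum w I powr (1 / r - 1 / k) * (\<Sum>i\<in>I. w i * x i powr k) powr (1 / k)"
proof -
  define M where "M = sum w I"
  have M: "M > 0" using assms by (simp add: M_def)
  define S where "S = (\<Sum>i\<in>I. w i * x i powr r)"
  define T where "T = (\<Sum>i\<in>I. w i * x i powr k)"
  have nn: "S \<ge> 0" "T \<ge> 0" unfolding S_def T_def using w by (auto intro!: sum_nonneg)
  have "(\<Sum>i\<in>I. w i / M * x i powr r) powr (k / r)
      \<le> (\<Sum>i\<in>I. w i / M * (x i powr r) powr (k / r))"
    using assms M
    by (intro powr_weighted_sum_le) (auto simp: M_def simp flip: sum_divide_distrib)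
  then have "(S / M) powr (k / r) \<le> T / M"
    using assms by (simp add: S_def T_def sum_divide_distrib powr_powr)
  then have "((S / M) powr (k / r)) powr (1 / k) \<le> (T / M) powr (1 / k)"
    using assms by (intro powr_mono2) auto
  then have "S powr (1 / r) / M powr (1 / r) \<le> T powr (1 / k) / M powr (1 / k)"
    using assms nn M by (simp add: powr_powr powr_divide)
  then have "S powr (1 / r) \<le> M powr (1 / r - 1 / k) * T powr (1 / k)"
    using M by (simp add: powr_diff field_simps)
  then show ?thesis by (simp add: S_def T_def M_def)
qed

text \<open>Convexity after normalisation: once each family is divided by its own weighted norm, the
  normalised sum is a convex combination of the two. A family of norm zero cannot be normalised and
  is treated first.\<close>

lemma weighted_Minkowski:
  fixes w x y :: "'i \<Rightarrow> real"
  assumes I: "finite I" and r: "r \<ge> 1"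
    and w: "\<And>i. i \<in> I \<Longrightarrow> w i \<ge> 0"
    and x: "\<And>i. i \<in> I \<Longrightarrow> x i \<ge> 0" and y: "\<And>i. i \<in> I \<Longrightarrow> y i \<ge> 0"
  shows "(\<Sum>i\<in>I. w i * (x i + y i) powr r) powr (1 / r)
    \<le> (\<Sum>i\<in>I. w i * x i powr r) powr (1 / r) + (\<Sum>i\<in>I. w i * y i powr r) powr (1 / r)"
proof -
  define S where "S = (\<Sum>i\<in>I. w i * x i powr r)"
  define T where "T = (\<Sum>i\<in>I. w i * y i powr r)"
  have nn: "S \<ge> 0" "T \<ge> 0" unfolding S_def T_def using w by (auto intro!: sum_nonneg)
  \<comment> \<open>A vanishing sum of nonnegative terms vanishes termwise, so
    \<open>w i = 0\<close> or \<open>g i = 0\<close>; either way \<open>g i\<close> may be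
    dropped.\<close>
  have null: "w i * (g i + h i) powr r = w i * h i powr r"
    if "(\<Sum>i\<in>I. w i * g i powr r) = 0" "i \<in> I" for g h i
    using sum_nonneg_eq_0_iff[of I "\<lambda>i. w i * g i powr r"] that I w by auto
  consider "S = 0" | "T = 0" | "S > 0" "T > 0" using nn by force
  then show ?thesis
  proof cases
    case 1
    then have "(\<Sum>i\<in>I. w i * (x i + y i) powr r) = T"
      unfolding T_def S_def by (intro sum.cong refl null) auto
    then show ?thesis by (simp add: T_def)
  next
    case 2
    then have "(\<Sum>i\<in>I. w i * (y i + x i) powr r) = S"
      unfolding T_def S_def by (intro sum.cong refl null) auto
    then show ?thesis by (simp add: S_def add.commute)
  next
    case 3
    define X where "X = S powr (1 / r)"
    define Y where "Y = T powr (1 / r)"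
    have pos: "X > 0" "Y > 0" using 3 by (auto simp: X_def Y_def)
    have Xr: "X powr r = S" and Yr: "Y powr r = T"
      using 3 r by (auto simp: X_def Y_def powr_powr)
    \<comment> \<open>Chosen so that \<open>(x i + y i) / (X + Y)\<close> is the convex combination
      of \<open>x i / X\<close> and \<open>y i / Y\<close> with weights \<open>1 - \<theta>\<close>
      and \<open>\<theta>\<close>.\<close>
    define \<theta> where "\<theta> = Y / (X + Y)"
    have \<theta>: "0 \<le> \<theta>" "\<theta> \<le> 1" "1 - \<theta> = X / (X + Y)"
      using pos by (auto simp: \<theta>_def field_simps)
    have "w i * ((x i + y i) / (X + Y)) powr r
        \<le> w i * ((1 - \<theta>) * (x i / X) powr r + \<theta> * (y i / Y) powr r)" if "i \<in> I" for i
    proof (rule mult_left_mono)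
      have "(1 - \<theta>) * (x i / X) + \<theta> * (y i / Y) = (x i + y i) / (X + Y)"
        unfolding \<theta>(3) using pos by (simp add: \<theta>_def add_divide_distrib)
      then show "((x i + y i) / (X + Y)) powr r
          \<le> (1 - \<theta>) * (x i / X) powr r + \<theta> * (y i / Y) powr r"
        using convex_onD[OF convex_on_powr_nonneg[OF r] \<theta>(1,2), of "x i / X" "y i / Y"]
          pos x y that by simp
    qed (use w that in simp)
    then have "(\<Sum>i\<in>I. w i * ((x i + y i) / (X + Y)) powr r)
        \<le> (\<Sum>i\<in>I. w i * ((1 - \<theta>) * (x i / X) powr r + \<theta> * (y i / Y) powr r))"
      by (rule sum_mono)
    \<comment> \<open>Since \<open>X powr r = S\<close> and \<open>Y powr r = T\<close>, each
      normalised family has weighted \<open>r\<close>-sum 1, and the bound becomes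
      \<open>(1 - \<theta>) + \<theta>\<close>.\<close>
    also have "\<dots> = (\<Sum>i\<in>I. (1 - \<theta>) / S * (w i * x i powr r) + \<theta> / T * (w i * y i powr r))"
      using pos x y by (intro sum.cong) (auto simp: powr_divide Xr Yr algebra_simps)
    also have "\<dots> = (1 - \<theta>) / S * S + \<theta> / T * T"
      unfolding S_def T_def by (simp only: sum.distrib sum_distrib_left)
    also have "\<dots> = 1" using 3 by simp
    finally have "(\<Sum>i\<in>I. w i * (x i + y i) powr r) / (X + Y) powr r \<le> 1"
      using pos x y by (simp add: powr_divide sum_divide_distrib)
    then have "(\<Sum>i\<in>I. w i * (x i + y i) powr r) \<le> (X + Y) powr r"
      using pos by (simp add: divide_le_eq)
    then have "(\<Sum>i\<in>I. w i * (x i + y i) powr r) powr (1 / r) \<le> ((X + Y) powr r) powr (1 / r)"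
      using r w by (intro powr_mono2 sum_nonneg) auto
    then show ?thesis
      using pos r by (simp add: powr_powr X_def Y_def S_def T_def)
  qed
qed

section \<open>Dual embedding, conjugate exponents and partitions\<close>

lemma to_dual_diff_scaleR: "to_dual \<iota> (k *\<^sub>R (g - h)) = k *\<^sub>R (to_dual \<iota> g - to_dual \<iota> h)"
  by (rule blinfun_eqI)
    (simp add: to_dual_def inner_diff_left blinfun.diff_left blinfun.scaleR_left)

lemma conj_exp_ge_1: "r > 1 \<Longrightarrow> conj_exp r \<ge> 1"
  by (simp add: conj_exp_def field_simps)

lemma conj_exp_antimono: "p > 1 \<Longrightarrow> p \<le> q \<Longrightarrow> conj_exp q \<le> conj_exp p"
  by (simp add: conj_exp_def field_simps)

lemma time_partition_step_pos: "time_partition tf N t \<Longrightarrow> n < N \<Longrightarrow> step t n > 0"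
  by (simp add: time_partition_def step_def)

lemma time_partition_sum_step: "time_partition tf N t \<Longrightarrow> (\<Sum>n<N. step t n) = tf"
  by (simp add: time_partition_def step_def sum_lessThan_telescope)

section \<open>Coercivity and growth of the operator along the stages\<close>

text \<open>Coercivity makes the pairing of \<open>\<A> w\<close> with \<open>w\<close> positive,
  hence \<open>\<A> w \<noteq> 0\<close>, and a nonpositive factor \<open>C3\<close> would
  contradict the growth bound. This is the source of the positivity of the supremum.\<close>

lemma coercive_growth_pos:
  assumes "coercive p \<A>" "growth \<iota> p q C3 \<A>" "w \<noteq> 0"
  shows "C3 (norm (\<iota> w)) > 0"
proof -
  obtain C1 where "C1 > 0" "blinfun_apply (\<A> w) w \<ge> C1 * norm w powr p"
    using assms(1) by (auto simp: coercive_def)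
  then have "\<A> w \<noteq> 0"
    using assms(3) by (smt (verit) mult_pos_pos powr_gt_zero zero_blinfun.rep_eq zero_less_norm_iff)
  then have "0 < C3 (norm (\<iota> w)) * norm w powr (p / conj_exp q)"
    using assms(2) by (smt (verit) growth_def zero_less_norm_iff)
  then show ?thesis
    by (simp add: zero_less_mult_iff)
qed

text \<open>At \<open>w = 0\<close> the growth bound forces \<open>\<A> w = 0\<close>, whatever the sign of \<open>C3\<close> there.\<close>

lemma norm_operator_le:
  assumes "growth \<iota> p q C3 \<A>" "w \<noteq> 0 \<Longrightarrow> C3 (norm (\<iota> w)) \<le> K"
  shows "norm (\<A> w) \<le> K * norm w powr (p / conj_exp q)"
proof (cases "w = 0")
  case False
  then show ?thesis
    using assms order_trans[OF _ mult_right_mono[OF assms(2)]] by (auto simp: growth_def)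
qed (use assms in \<open>auto simp: growth_def dest!: spec[of _ 0]\<close>)

lemma C3_le_Sup_stage_growth_values:
  assumes "bdd_above (stage_growth_values \<iota> f \<A> u0 tf s a b c C3)"
    and "time_partition tf N t" "dirk_solution \<iota> f \<A> u0 s a b c N t u v" "n < N" "i \<in> {1..s}"
  shows "C3 (norm (\<iota> (v n i))) \<le> Sup (stage_growth_values \<iota> f \<A> u0 tf s a b c C3)"
proof -
  have "C3 (norm (\<iota> (v n i))) \<le> Max ((\<lambda>i. C3 (norm (\<iota> (v n i)))) ` {1..s})"
    using assms(5) by (intro Max_ge) auto
  also have "\<dots> \<le> Sup (stage_growth_values \<iota> f \<A> u0 tf s a b c C3)"
  proof (rule cSup_upper[OF _ assms(1)])
    show "Max ((\<lambda>i. C3 (norm (\<iota> (v n i)))) ` {1..s})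
        \<in> stage_growth_values \<iota> f \<A> u0 tf s a b c C3"
      unfolding stage_growth_values_def using assms(2-4) by blast
  qed
  finally show ?thesis .
qed

section \<open>Estimates for the difference quotients\<close>

text \<open>The embedding is linear, so the update equation divided by the step size identifies the
  quotient with the \<open>b\<close>-weighted sum of slopes; the triangle inequality does the
  rest.\<close>

lemma norm_difference_quotient_le:
  assumes "dirk_solution \<iota> f \<A> u0 s a b c N t u v" "n < N" "step t n > 0"
    and "\<And>j. j \<in> {1..s} \<Longrightarrow> b j \<ge> 0"
  shows "norm (to_dual \<iota> ((u (Suc n) - u n) /\<^sub>R step t n))
    \<le> (\<Sum>j=1..s. b j * (norm (f (t n + c j * step t n)) + norm (\<A> (v n j))))"
proof -
  have "to_dual \<iota> ((u (Suc n) - u n) /\<^sub>R step t n)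
      = (\<Sum>j=1..s. b j *\<^sub>R stage_slope f \<A> c t v n j)"
    using assms unfolding to_dual_diff_scaleR by (simp add: dirk_solution_def)
  also have "norm \<dots> \<le> (\<Sum>j=1..s. b j * (norm (f (t n + c j * step t n)) + norm (\<A> (v n j))))"
    using assms(4)
    by (intro sum_norm_le)
      (auto simp: stage_slope_def stage_rhs_def intro!: mult_left_mono norm_triangle_ineq4)
  finally show ?thesis .
qed

text \<open>Only \<open>K \<ge> 0\<close> can be pulled out of the root; the supremum itself may be negative when all
  stages vanish.\<close>

lemma weighted_difference_quotients_le:
  fixes \<gamma> \<omega> :: "nat \<Rightarrow> real"
  assumes p: "p > 1" and q: "q \<ge> p" and tf: "tf > 0" and \<mu>: "\<mu> > 0" and K: "K \<ge> 0"
    and part: "time_partition tf N t" and sol: "dirk_solution \<iota> f \<A> u0 s a b c N t u v"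
    and b: "\<And>j. j \<in> {1..s} \<Longrightarrow> b j \<in> {0..1}" and b1: "(\<Sum>j=1..s. b j) = 1"
    and \<mu>le: "\<And>j. j \<in> {1..s} \<Longrightarrow> \<mu> \<le> \<gamma> j \<and> \<mu> \<le> \<omega> j"
    and op: "\<And>n j. n < N \<Longrightarrow> j \<in> {1..s} \<Longrightarrow>
      norm (\<A> (v n j)) \<le> K * norm (v n j) powr (p / conj_exp q)"
  shows "(\<mu> * (\<Sum>n<N. step t n *
      norm (to_dual \<iota> ((u (Suc n) - u n) /\<^sub>R step t n)) powr conj_exp q)) powr (1 / conj_exp q)
    \<le> (\<mu> * tf) powr ((conj_exp p - conj_exp q) / (conj_exp p * conj_exp q)) *
        (\<Sum>n<N. step t n *
          (\<Sum>i=1..s. \<gamma> i * norm (f (t n + c i * step t n)) powr conj_exp p)) powr (1 / conj_exp p)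
      + K * (\<Sum>n<N. step t n * (\<Sum>i=1..s. \<omega> i * norm (v n i) powr p)) powr (1 / conj_exp q)"
proof -
  define r where "r = conj_exp q"
  define k where "k = conj_exp p"
  have r: "r \<ge> 1" and k: "k \<ge> 1" and rk: "r \<le> k"
    using p q by (auto simp: r_def k_def conj_exp_ge_1 conj_exp_antimono)
  define \<tau> where "\<tau> = step t"
  have \<tau>: "\<tau> n > 0" if "n < N" for n
    using that part by (simp add: \<tau>_def time_partition_step_pos)
  define I where "I = {..<N} \<times> {1..s}"
  define m where "m = (\<lambda>(n, j). \<mu> * \<tau> n * b j)"
  define x where "x = (\<lambda>(n, j). norm (f (t n + c j * \<tau> n)))"
  define y where "y = (\<lambda>(n, j). norm (\<A> (v n j)))"
  define D where "D n = norm (to_dual \<iota> ((u (Suc n) - u n) /\<^sub>R \<tau> n))" for n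
  have I: "finite I" by (simp add: I_def)
  have m: "m z \<ge> 0" if "z \<in> I" for z
    using that \<tau> \<mu> b by (force simp: I_def m_def)
  \<comment> \<open>The \<open>b j\<close> sum to 1 and the step sizes telescope to
    \<open>tf\<close>.\<close>
  have sum_m: "sum m I = \<mu> * tf"
  proof -
    have "sum m I = (\<Sum>n<N. \<mu> * \<tau> n * (\<Sum>j=1..s. b j))"
      by (simp add: I_def m_def sum.cartesian_product' sum_distrib_left)
    then show ?thesis
      using b1 time_partition_sum_step[OF part] by (simp add: \<tau>_def flip: sum_distrib_left)
  qed
  \<comment> \<open>Kept general in \<open>h\<close> and \<open>g\<close> because it serves twice:
    with \<open>\<gamma>\<close> for the data and with \<open>\<omega>\<close> for the stage
    norms.\<close>
  have weights: "(\<Sum>z\<in>I. m z * g z) \<le> (\<Sum>n<N. \<tau> n * (\<Sum>j=1..s. h j * g (n, j)))"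
    if "\<And>j. j \<in> {1..s} \<Longrightarrow> \<mu> \<le> h j" "\<And>z. z \<in> I \<Longrightarrow> g z \<ge> 0" for g h
  proof -
    have "\<mu> * \<tau> n * b j * g (n, j) \<le> \<tau> n * (h j * g (n, j))" if "n < N" "j \<in> {1..s}" for n j
    proof -
      have "\<mu> * b j \<le> h j"
        using b[OF that(2)] \<mu> \<open>\<And>j. j \<in> {1..s} \<Longrightarrow> \<mu> \<le> h j\<close>[OF that(2)]
        by (intro order_trans[OF mult_left_le[of "b j" \<mu>]]) auto
      then have "(\<mu> * b j) * (\<tau> n * g (n, j)) \<le> h j * (\<tau> n * g (n, j))"
        using \<tau>[of n] that \<open>\<And>z. z \<in> I \<Longrightarrow> g z \<ge> 0\<close>[of "(n, j)"]
        by (intro mult_right_mono) (auto simp: I_def)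
      then show ?thesis by (simp add: mult_ac)
    qed
    then show ?thesis
      by (auto simp: I_def m_def sum.cartesian_product' sum_distrib_left intro!: sum_mono)
  qed
  \<comment> \<open>Jensen over the stages of a single step; the weights \<open>b j\<close> have
    mass 1, so no constant appears.\<close>
  have "D n powr r \<le> (\<Sum>j=1..s. b j * (x (n, j) + y (n, j)) powr r)" if "n < N" for n
  proof -
    have "D n \<le> (\<Sum>j=1..s. b j * (x (n, j) + y (n, j)))"
      using norm_difference_quotient_le[OF sol that] \<tau>[OF that] b
      by (auto simp: D_def x_def y_def \<tau>_def)
    then have "D n powr r \<le> (\<Sum>j=1..s. b j * (x (n, j) + y (n, j))) powr r"
      using r by (intro powr_mono2) (auto simp: D_def)
    also have "\<dots> \<le> (\<Sum>j=1..s. b j * (x (n, j) + y (n, j)) powr r)"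
      using r b b1 by (intro powr_weighted_sum_le) (auto simp: x_def y_def)
    finally show ?thesis .
  qed
  then have "\<mu> * (\<Sum>n<N. \<tau> n * D n powr r)
      \<le> \<mu> * (\<Sum>n<N. \<tau> n * (\<Sum>j=1..s. b j * (x (n, j) + y (n, j)) powr r))"
    using \<mu> \<tau> by (intro mult_left_mono sum_mono) (auto simp: less_imp_le)
  also have "\<dots> = (\<Sum>z\<in>I. m z * (x z + y z) powr r)"
    by (simp add: I_def m_def sum.cartesian_product' sum_distrib_left mult.assoc)
  finally have "(\<mu> * (\<Sum>n<N. \<tau> n * D n powr r)) powr (1 / r)
      \<le> (\<Sum>z\<in>I. m z * (x z + y z) powr r) powr (1 / r)"
  proof (intro powr_mono2 mult_nonneg_nonneg sum_nonneg)
    show "\<tau> n \<ge> 0" if "n \<in> {..<N}" for n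
      using \<tau>[of n] that by simp
  qed (use r \<mu> in auto)
  also have "\<dots> \<le> (\<Sum>z\<in>I. m z * x z powr r) powr (1 / r)
      + (\<Sum>z\<in>I. m z * y z powr r) powr (1 / r)"
    using I r m by (intro weighted_Minkowski) (auto simp: x_def y_def)
  finally have split: "(\<mu> * (\<Sum>n<N. \<tau> n * D n powr r)) powr (1 / r)
      \<le> (\<Sum>z\<in>I. m z * x z powr r) powr (1 / r) + (\<Sum>z\<in>I. m z * y z powr r) powr (1 / r)" .
  \<comment> \<open>Raising the exponent from \<open>r\<close> to \<open>k\<close> costs the mass
    \<open>\<mu> * tf\<close> to the power \<open>1 / r - 1 / k\<close>, which is the exponent of
    the claim over a common denominator.\<close>
  have "(\<Sum>z\<in>I. m z * x z powr r) powr (1 / r)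
      \<le> (\<mu> * tf) powr (1 / r - 1 / k) * (\<Sum>z\<in>I. m z * x z powr k) powr (1 / k)"
    using weighted_power_mean_le[OF I _ rk, of m x] r m sum_m \<mu> tf by auto
  also have "\<dots> \<le> (\<mu> * tf) powr (1 / r - 1 / k)
      * (\<Sum>n<N. \<tau> n * (\<Sum>j=1..s. \<gamma> j * x (n, j) powr k)) powr (1 / k)"
    using k \<mu>le m by (intro mult_left_mono powr_mono2 weights sum_nonneg) auto
  also have "1 / r - 1 / k = (k - r) / (k * r)"
    using r k by (simp add: field_simps)
  finally have data: "(\<Sum>z\<in>I. m z * x z powr r) powr (1 / r)
      \<le> (\<mu> * tf) powr ((k - r) / (k * r))
        * (\<Sum>n<N. \<tau> n * (\<Sum>j=1..s. \<gamma> j * x (n, j) powr k)) powr (1 / k)" .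
  have operator: "(\<Sum>z\<in>I. m z * y z powr r) powr (1 / r)
      \<le> K * (\<Sum>n<N. \<tau> n * (\<Sum>j=1..s. \<omega> j * norm (v n j) powr p)) powr (1 / r)"
  proof -
    define g where "g = (\<lambda>(n, j). norm (v n j) powr p)"
    \<comment> \<open>The growth exponent \<open>p / r\<close> is such that the \<open>r\<close>-th
      power produces exactly the \<open>p\<close>-th power of the stage norm.\<close>
    have "y z powr r \<le> K powr r * g z" if z: "z \<in> I" for z
    proof -
      obtain n j where nj: "z = (n, j)" "n < N" "j \<in> {1..s}"
        using z by (auto simp: I_def)
      have "y z powr r \<le> (K * norm (v n j) powr (p / r)) powr r"
        using op[OF nj(2,3)] r by (intro powr_mono2) (auto simp: y_def nj r_def)
      then show ?thesis
        using r by (simp add: g_def nj powr_mult powr_powr)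
    qed
    then have "(\<Sum>z\<in>I. m z * y z powr r) \<le> (\<Sum>z\<in>I. m z * (K powr r * g z))"
      using m by (intro sum_mono mult_left_mono) auto
    also have "\<dots> = K powr r * (\<Sum>z\<in>I. m z * g z)"
      by (simp add: sum_distrib_left mult_ac)
    also have "\<dots> \<le> K powr r * (\<Sum>n<N. \<tau> n * (\<Sum>j=1..s. \<omega> j * g (n, j)))"
      using \<mu>le by (intro mult_left_mono weights) (auto simp: g_def)
    finally have "(\<Sum>z\<in>I. m z * y z powr r) powr (1 / r)
        \<le> (K powr r * (\<Sum>n<N. \<tau> n * (\<Sum>j=1..s. \<omega> j * g (n, j)))) powr (1 / r)"
      using r m by (intro powr_mono2 sum_nonneg) auto
    then show ?thesis
      using r K by (simp add: powr_mult powr_powr g_def)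
  qed
  show ?thesis
    using order_trans[OF split add_mono[OF data operator]]
    by (simp add: D_def x_def \<tau>_def r_def k_def)
qed

section \<open>The growth constant, its sign and the final estimate\<close>

text \<open>Positivity of \<open>\<CC>\<^sub>3\<close> is conditional on a nonzero stage: at
  \<open>w = 0\<close> the growth bound reads \<open>norm (\<A> 0) \<le> 0\<close> and leaves the
  sign of \<open>C3 0\<close> open.\<close>

theorem proposition6p10:
  fixes \<iota> :: "'v::banach \<Rightarrow>\<^sub>L 'h::{real_inner, complete_space}"
    and f :: "real \<Rightarrow> ('v \<Rightarrow>\<^sub>L real)"
    and \<A> :: "'v \<Rightarrow> ('v \<Rightarrow>\<^sub>L real)"
    and u0 :: 'h
    and tf p q CA Cf \<mu> \<CC>\<^sub>3 :: real
    and C3 :: "real \<Rightarrow> real"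
    and s :: nat
    and a :: "nat \<Rightarrow> nat \<Rightarrow> real"
    and b c \<omega> \<gamma> :: "nat \<Rightarrow> real"
  defines "\<mu> \<equiv> min (Min (\<gamma> ` {1..s})) (Min (\<omega> ` {1..s}))"
    and "\<CC>\<^sub>3 \<equiv> Sup (stage_growth_values \<iota> f \<A> u0 tf s a b c C3)"
  assumes "gelfand_triple \<iota>"
    and "tf > 0"
    and "p > 1" and "q \<ge> p"
    and "locally_solvable \<iota> \<A>"
    and "coercive p \<A>"
    and "growth \<iota> p q C3 \<A>"
    and "dirk_tableau s a b c"
    and "first_order s a b c"
    and "discretely_Bochner_stable \<iota> f \<A> u0 tf s a b c p q CA Cf \<omega> \<gamma>"
    and "bdd_above (stage_growth_values \<iota> f \<A> u0 tf s a b c C3)"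
  shows "(\<forall>N t u v. time_partition tf N t \<and> dirk_solution \<iota> f \<A> u0 s a b c N t u v \<longrightarrow>
           (\<mu> * (\<Sum>n<N. step t n *
               norm (to_dual \<iota> ((u (Suc n) - u n) /\<^sub>R step t n)) powr conj_exp q)) powr (1 / conj_exp q)
           \<le> (\<mu> * tf) powr ((conj_exp p - conj_exp q) / (conj_exp p * conj_exp q)) *
               (\<Sum>n<N. step t n *
                  (\<Sum>i=1..s. \<gamma> i * norm (f (t n + c i * step t n)) powr conj_exp p)) powr (1 / conj_exp p)
             + \<CC>\<^sub>3 * (\<Sum>n<N. step t n *
                  (\<Sum>i=1..s. \<omega> i * norm (v n i) powr p)) powr (1 / conj_exp q)) \<and>
         ((\<exists>N t u v. time_partition tf N t \<and> dirk_solution \<iota> f \<A> u0 s a b c N t u v \<and>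
             (\<exists>n<N. \<exists>i\<in>{1..s}. v n i \<noteq> 0)) \<longrightarrow> \<CC>\<^sub>3 > 0)"
proof (intro conjI allI impI; (elim conjE exE bexE)?)
  have s: "s \<ge> 1" and b: "\<And>j. j \<in> {1..s} \<Longrightarrow> b j \<in> {0..1}"
    using \<open>dirk_tableau s a b c\<close> by (auto simp: dirk_tableau_def)
  have b1: "(\<Sum>j=1..s. b j) = 1"
    using \<open>first_order s a b c\<close> by (simp add: first_order_def)
  have "\<forall>i\<in>{1..s}. \<omega> i > 0 \<and> \<gamma> i > 0"
    using \<open>discretely_Bochner_stable \<iota> f \<A> u0 tf s a b c p q CA Cf \<omega> \<gamma>\<close>
    by (simp add: discretely_Bochner_stable_def)
  then have \<mu>: "\<mu> > 0"
    using s by (auto simp: \<mu>_def)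
  have \<mu>le: "\<mu> \<le> \<gamma> j \<and> \<mu> \<le> \<omega> j" if "j \<in> {1..s}" for j
    using that by (auto simp: \<mu>_def min_le_iff_disj)
  note C3_le = C3_le_Sup_stage_growth_values
    [OF \<open>bdd_above (stage_growth_values \<iota> f \<A> u0 tf s a b c C3)\<close>, folded \<CC>\<^sub>3_def]
  have \<CC>\<^sub>3_pos: "\<CC>\<^sub>3 > 0"
    if "time_partition tf N t" "dirk_solution \<iota> f \<A> u0 s a b c N t u v"
      "n < N" "i \<in> {1..s}" "v n i \<noteq> 0" for N t u v n i
    using coercive_growth_pos[OF \<open>coercive p \<A>\<close> \<open>growth \<iota> p q C3 \<A>\<close> that(5)]
      C3_le[OF that(1-4)] by linarith
  then show "\<CC>\<^sub>3 > 0"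
    if "time_partition tf N t" "dirk_solution \<iota> f \<A> u0 s a b c N t u v"
      "n < N" "i \<in> {1..s}" "v n i \<noteq> 0" for N t u v n i
    using that by blast
  fix N t u v
  assume part: "time_partition tf N t" and sol: "dirk_solution \<iota> f \<A> u0 s a b c N t u v"
  \<comment> \<open>A nonnegative substitute for \<open>\<CC>\<^sub>3\<close>, as extracting the
    root of its power requires.\<close>
  define K where "K = max 0 \<CC>\<^sub>3"
  have K: "K \<ge> 0" by (simp add: K_def)
  have op: "norm (\<A> (v n j)) \<le> K * norm (v n j) powr (p / conj_exp q)"
    if "n < N" "j \<in> {1..s}" for n j
    using C3_le[OF part sol that]
    by (intro norm_operator_le[OF \<open>growth \<iota> p q C3 \<A>\<close>]) (simp add: K_def)
  \<comment> \<open>The substitution is harmless: if \<open>\<CC>\<^sub>3\<close> is not positive,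
    every stage is zero, and both sides vanish because 0 \<open>powr\<close> anything is 0.\<close>
  have K_eq: "K * (\<Sum>n<N. step t n * (\<Sum>i=1..s. \<omega> i * norm (v n i) powr p)) powr (1 / conj_exp q)
      = \<CC>\<^sub>3 * (\<Sum>n<N. step t n * (\<Sum>i=1..s. \<omega> i * norm (v n i) powr p)) powr (1 / conj_exp q)"
  proof (cases "\<CC>\<^sub>3 > 0")
    case True
    then show ?thesis by (simp add: K_def)
  next
    case False
    then have "v n i = 0" if "n < N" "i \<in> {1..s}" for n i
      using \<CC>\<^sub>3_pos[OF part sol that] by blast
    then have "(\<Sum>n<N. step t n * (\<Sum>i=1..s. \<omega> i * norm (v n i) powr p)) = 0"
      by (intro sum.neutral) auto
    then show ?thesis by simp
  qed
  show "(\<mu> * (\<Sum>n<N. step t n *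
      norm (to_dual \<iota> ((u (Suc n) - u n) /\<^sub>R step t n)) powr conj_exp q)) powr (1 / conj_exp q)
    \<le> (\<mu> * tf) powr ((conj_exp p - conj_exp q) / (conj_exp p * conj_exp q)) *
        (\<Sum>n<N. step t n *
          (\<Sum>i=1..s. \<gamma> i * norm (f (t n + c i * step t n)) powr conj_exp p)) powr (1 / conj_exp p)
      + \<CC>\<^sub>3 * (\<Sum>n<N. step t n *
          (\<Sum>i=1..s. \<omega> i * norm (v n i) powr p)) powr (1 / conj_exp q)"
    unfolding K_eq[symmetric]
    by (rule weighted_difference_quotients_le) (fact | erule b \<mu>le | erule (1) op)+
qed

end
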